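(* Let $A$ and $B$ be two random variables on a probability space $(\Omega,\mathcal F,\mathbb P)$ with values in a measurable space $(X,\mathcal B_X)$, and let $R_{A,B}$ be the transfer operator from $A$ to $B$. Then $A$ and $B$ are independent if and only if $R_{A,B}$ has rank $1$.
   Context: $\mu_A(L)=\mathbb P(A^{-1}(L))$, $L\in\mathcal B_X$, is the distribution of $A$, and similarly $\mu_B$. The map $V_Af=f\circ A$ is an isometry from $\mathbf L_2(X,\mathcal B_X,\mu_A)$ into $\mathbf L_2(\Omega,\mathcal F,\mathbb P)$, and similarly $V_B$. The transfer operator is $R_{A,B}=V_A^*V_B:\mathbf L_2(X,\mathcal B_X,\mu_B)\to\mathbf L_2(X,\mathcal B_X,\mu_A)$. *)

theory Defs
  imports "HOL-Probability.Probability" "Jordan_Normal_Form.VS_Connect"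
begin

section \<open>The space of square-integrable functions\<close>

definition square_integrable :: "'a measure \<Rightarrow> ('a \<Rightarrow> complex) set" where
  "square_integrable M =
    {f \<in> borel_measurable M. integrable M (\<lambda>x. (cmod (f x))\<^sup>2)}"

definition ae_rel :: "'a measure \<Rightarrow> (('a \<Rightarrow> complex) \<times> ('a \<Rightarrow> complex)) set" where
  "ae_rel M =
    {(f, g). f \<in> square_integrable M \<and> g \<in> square_integrable M \<and> (AE x in M. f x = g x)}"

abbreviation ae_class :: "'a measure \<Rightarrow> ('a \<Rightarrow> complex) \<Rightarrow> ('a \<Rightarrow> complex) set" where
  "ae_class M f \<equiv> ae_rel M `` {f}"

text \<open>
  Elements of \<open>L2 M\<close> are classes of functions modulo equality almost everywhere. An operation
  on classes is the union, over all choices of representatives, of the resulting classes; these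
  all coincide. The record type of modules extends that of rings, so the
  fields \<open>mult\<close> and \<open>one\<close> have to be given a value, but they play no role in a vector space.
\<close>

definition L2 :: "'a measure \<Rightarrow> (complex, ('a \<Rightarrow> complex) set) module" where
  "L2 M = \<lparr>
    carrier = square_integrable M // ae_rel M,
    mult = (\<lambda>F G. ae_class M (\<lambda>_. 0)),
    one = ae_class M (\<lambda>_. 0),
    zero = ae_class M (\<lambda>_. 0),
    add = (\<lambda>F G. \<Union>f\<in>F. \<Union>g\<in>G. ae_class M (\<lambda>x. f x + g x)),
    smult = (\<lambda>c F. \<Union>f\<in>F. ae_class M (\<lambda>x. c * f x))\<rparr>"

definition L2_inner :: "'a measure \<Rightarrow> ('a \<Rightarrow> complex) set \<Rightarrow> ('a \<Rightarrow> complex) set \<Rightarrow> complex" where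
  "L2_inner M F G = the_elem (\<Union>f\<in>F. \<Union>g\<in>G. {integral\<^sup>L M (\<lambda>x. f x * cnj (g x))})"


section \<open>Adjoint and rank of operators\<close>

definition L2_adjoint ::
  "'a measure \<Rightarrow> 'b measure \<Rightarrow> (('a \<Rightarrow> complex) set \<Rightarrow> ('b \<Rightarrow> complex) set)
    \<Rightarrow> ('b \<Rightarrow> complex) set \<Rightarrow> ('a \<Rightarrow> complex) set" where
  "L2_adjoint M N T G =
    (THE F. F \<in> carrier (L2 M) \<and>
      (\<forall>H\<in>carrier (L2 M). L2_inner N (T H) G = L2_inner M H F))"

text \<open>
  The rank of \<open>T\<close> is the dimension of its range. Finite-dimensionality is required
  explicitly, because \<open>vectorspace.dim\<close> is unspecified for spaces of infinite dimension.
\<close>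

definition has_rank ::
  "('k::field, 'v) module \<Rightarrow> ('k, 'w) module \<Rightarrow> ('v \<Rightarrow> 'w) \<Rightarrow> nat \<Rightarrow> bool" where
  "has_rank V W T n \<longleftrightarrow>
    vectorspace.fin_dim class_ring (W\<lparr>carrier := T ` carrier V\<rparr>) \<and>
    vectorspace.dim class_ring (W\<lparr>carrier := T ` carrier V\<rparr>) = n"


section \<open>The transfer operator of two random variables\<close>

text \<open>The operator \<open>f \<mapsto> f \<circ> A\<close> from \<open>L2 (distr P X A)\<close> to \<open>L2 P\<close>.\<close>

definition comp_op :: "'w measure \<Rightarrow> ('w \<Rightarrow> 'x) \<Rightarrow> ('x \<Rightarrow> complex) set \<Rightarrow> ('w \<Rightarrow> complex) set" where
  "comp_op P A F = (\<Union>f\<in>F. ae_class P (f \<circ> A))"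

definition transfer_op ::
  "'w measure \<Rightarrow> 'x measure \<Rightarrow> ('w \<Rightarrow> 'x) \<Rightarrow> ('w \<Rightarrow> 'x)
    \<Rightarrow> ('x \<Rightarrow> complex) set \<Rightarrow> ('x \<Rightarrow> complex) set" where
  "transfer_op P X A B = L2_adjoint (distr P X A) P (comp_op P A) \<circ> comp_op P B"

end

theory Submission
  imports Defs
begin

text \<open>
  On functions, \<open>transfer_op P X A B\<close> sends \<open>f\<close> to the conditional expectation of \<open>f \<circ> B\<close> given \<open>A\<close>,
  written as a function of the value of \<open>A\<close>. The adjoint of \<open>h \<mapsto> h \<circ> A\<close> takes \<open>g\<close> to the unique
  class \<open>k\<close> with \<open>\<integral> h(A) cnj g dP = \<integral> h cnj k d\<mu>\<^sub>A\<close> for all square-integrable \<open>h\<close>; for \<open>g = f \<circ> B\<close>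
  this is the defining property of that conditional expectation. A function \<open>k\<close> with this property
  is called a conditional mean of \<open>g\<close> here (\<open>is_cond_mean\<close>).

  The constant function \<open>1\<close> is sent to \<open>1\<close>, which is not the zero class because the distribution of \<open>A\<close>
  has mass one. So the range always contains the line of constants, and the rank is one exactly when
  the range is that line, that is, when every \<open>f \<circ> B\<close> has a constant conditional mean
  (\<open>transfer_op_rank_one_iff\<close>). If \<open>A\<close> and \<open>B\<close> are independent, the expectation of \<open>f \<circ> B\<close> is such a
  constant, since the integral of \<open>h(A) cnj (f(B))\<close> factors. Conversely, if the conditional mean of the
  indicator of \<open>B \<in> L\<close> is a constant \<open>c\<close>, testing against indicators of \<open>A \<in> K\<close> gives
  \<open>P(A \<in> K, B \<in> L) = P(A \<in> K) cnj c\<close>; the choice \<open>K = X\<close> identifies \<open>cnj c\<close> as \<open>P(B \<in> L)\<close>.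

  The analytic content is the existence of conditional means (\<open>cond_mean_exists\<close>). It makes the
  adjoint well defined on all of \<open>L2 P\<close>, hence the transfer operator linear, so that its range is a
  vector space with a dimension. It follows from the Radon-Nikodym theorem on \<open>X\<close>, together with a
  truncation argument showing that the density obtained is square-integrable.
\<close>

section \<open>Square-integrable functions\<close>

lemma borel_measurable_cnj [measurable]:
  assumes "f \<in> borel_measurable M"
  shows "(\<lambda>x. cnj (f x)) \<in> borel_measurable M"
  by (rule borel_measurable_continuous_on[OF _ assms]) (intro continuous_intros)

lemma square_integrableD:
  assumes "f \<in> square_integrable M"
  shows "f \<in> borel_measurable M" and "integrable M (\<lambda>x. (cmod (f x))\<^sup>2)"
  using assms by (auto simp: square_integrable_def)

lemma square_integrableI:
  assumes "f \<in> borel_measurable M" and "integrable M (\<lambda>x. (cmod (f x))\<^sup>2)"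
  shows "f \<in> square_integrable M"
  using assms by (auto simp: square_integrable_def)

lemma square_integrable_add:
  assumes f: "f \<in> square_integrable M" and g: "g \<in> square_integrable M"
  shows "(\<lambda>x. f x + g x) \<in> square_integrable M"
proof (rule square_integrableI)
  note [measurable] = square_integrableD(1)[OF f] square_integrableD(1)[OF g]
  show "(\<lambda>x. f x + g x) \<in> borel_measurable M" by measurable
  have "(cmod (f x + g x))\<^sup>2 \<le> 2 * (cmod (f x))\<^sup>2 + 2 * (cmod (g x))\<^sup>2" for x
  proof -
    have "(cmod (f x + g x))\<^sup>2 \<le> (cmod (f x) + cmod (g x))\<^sup>2"
      by (intro power_mono norm_triangle_ineq) auto
    also have "\<dots> \<le> 2 * (cmod (f x))\<^sup>2 + 2 * (cmod (g x))\<^sup>2"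
      using sum_squares_bound[of "cmod (f x)" "cmod (g x)"] by (simp add: power2_sum)
    finally show ?thesis .
  qed
  then have "AE x in M. norm ((cmod (f x + g x))\<^sup>2) \<le> norm (2 * (cmod (f x))\<^sup>2 + 2 * (cmod (g x))\<^sup>2)"
    by (intro AE_I2) simp
  moreover have "integrable M (\<lambda>x. 2 * (cmod (f x))\<^sup>2 + 2 * (cmod (g x))\<^sup>2)"
    using square_integrableD(2)[OF f] square_integrableD(2)[OF g] by simp
  ultimately show "integrable M (\<lambda>x. (cmod (f x + g x))\<^sup>2)"
    by (intro Bochner_Integration.integrable_bound
        [where g = "\<lambda>x. (cmod (f x + g x))\<^sup>2"]) measurable
qed

lemma square_integrable_scale:
  assumes "f \<in> square_integrable M"
  shows "(\<lambda>x. c * f x) \<in> square_integrable M"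
  using assms by (auto simp: square_integrable_def norm_mult power_mult_distrib)

lemma square_integrable_diff:
  assumes "f \<in> square_integrable M" and "g \<in> square_integrable M"
  shows "(\<lambda>x. f x - g x) \<in> square_integrable M"
  using square_integrable_add[OF assms(1) square_integrable_scale[OF assms(2), of "-1"]] by simp

lemma (in finite_measure) square_integrable_bounded:
  fixes f :: "'a \<Rightarrow> complex"
  assumes [measurable]: "f \<in> borel_measurable M" and "\<And>x. cmod (f x) \<le> C"
  shows "f \<in> square_integrable M"
proof (rule square_integrableI)
  show "integrable M (\<lambda>x. (cmod (f x))\<^sup>2)"
    using assms(2) by (intro integrable_const_bound[where B = "C\<^sup>2"]) (auto intro!: power_mono)
qed fact

lemma square_integrable_integrable_inner:
  assumes f: "f \<in> square_integrable M" and g: "g \<in> square_integrable M"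
  shows "integrable M (\<lambda>x. f x * cnj (g x))"
proof -
  note [measurable] = square_integrableD(1)[OF f] square_integrableD(1)[OF g]
  have "cmod (f x * cnj (g x)) \<le> (cmod (f x))\<^sup>2 + (cmod (g x))\<^sup>2" for x
    using sum_squares_bound[of "cmod (f x)" "cmod (g x)"]
    by (simp add: norm_mult mult.assoc) (smt (verit) mult_nonneg_nonneg norm_ge_zero)
  then have "AE x in M. norm (f x * cnj (g x)) \<le> norm ((cmod (f x))\<^sup>2 + (cmod (g x))\<^sup>2)"
    by (intro AE_I2) simp
  moreover have "integrable M (\<lambda>x. (cmod (f x))\<^sup>2 + (cmod (g x))\<^sup>2)"
    using square_integrableD(2)[OF f] square_integrableD(2)[OF g] by simp
  ultimately show ?thesis
    by (intro Bochner_Integration.integrable_bound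
        [where g = "\<lambda>x. f x * cnj (g x)"]) measurable
qed

section \<open>The vector space of classes\<close>

lemma equiv_ae_rel: "equiv (square_integrable M) (ae_rel M)"
proof (rule equivI)
  show "sym (ae_rel M)"
    by (auto simp: ae_rel_def sym_def eq_commute)
  show "trans (ae_rel M)"
  proof (rule transI)
    fix f g h assume fgh: "(f, g) \<in> ae_rel M" "(g, h) \<in> ae_rel M"
    then have "AE x in M. f x = g x" "AE x in M. g x = h x"
      by (auto simp: ae_rel_def)
    then have "AE x in M. f x = h x"
      by eventually_elim simp
    then show "(f, h) \<in> ae_rel M"
      using fgh by (simp add: ae_rel_def)
  qed
qed (auto simp: ae_rel_def refl_on_def)

lemma ae_class_eq_iff:
  assumes "f \<in> square_integrable M" and "g \<in> square_integrable M"
  shows "ae_class M f = ae_class M g \<longleftrightarrow> (AE x in M. f x = g x)"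
  using eq_equiv_class_iff[OF equiv_ae_rel assms] assms by (simp add: ae_rel_def)

lemma L2_carrier: "carrier (L2 M) = ae_class M ` square_integrable M"
  by (auto simp: L2_def quotient_def)

lemma L2_zero: "\<zero>\<^bsub>L2 M\<^esub> = ae_class M (\<lambda>_. 0)"
  by (simp add: L2_def)

text \<open>
  The unions over representatives in the operations of \<open>L2 M\<close> collapse because the operations
  respect equality almost everywhere; this reduces calculations with classes to calculations with
  functions.
\<close>
lemma L2_add:
  assumes "f \<in> square_integrable M" and "g \<in> square_integrable M"
  shows "ae_class M f \<oplus>\<^bsub>L2 M\<^esub> ae_class M g = ae_class M (\<lambda>x. f x + g x)"
proof -
  have "congruent2 (ae_rel M) (ae_rel M) (\<lambda>f g. ae_class M (\<lambda>x. f x + g x))"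
  proof (rule congruent2I')
    fix f f' g g' assume rel: "(f, f') \<in> ae_rel M" "(g, g') \<in> ae_rel M"
    then have "AE x in M. f x = f' x" "AE x in M. g x = g' x"
      by (auto simp: ae_rel_def)
    then have "AE x in M. f x + g x = f' x + g' x"
      by eventually_elim simp
    then show "ae_class M (\<lambda>x. f x + g x) = ae_class M (\<lambda>x. f' x + g' x)"
      using rel by (subst ae_class_eq_iff) (auto simp: ae_rel_def square_integrable_add)
  qed
  then show ?thesis
    unfolding L2_def by (simp add: UN_equiv_class2[OF equiv_ae_rel equiv_ae_rel _ assms])
qed

lemma L2_smult:
  assumes "f \<in> square_integrable M"
  shows "c \<odot>\<^bsub>L2 M\<^esub> ae_class M f = ae_class M (\<lambda>x. c * f x)"
proof -
  have "congruent (ae_rel M) (\<lambda>f. ae_class M (\<lambda>x. c * f x))"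
  proof (rule congruentI)
    fix f f' assume rel: "(f, f') \<in> ae_rel M"
    then have "AE x in M. f x = f' x"
      by (auto simp: ae_rel_def)
    then have "AE x in M. c * f x = c * f' x"
      by eventually_elim simp
    then show "ae_class M (\<lambda>x. c * f x) = ae_class M (\<lambda>x. c * f' x)"
      using rel by (subst ae_class_eq_iff) (auto simp: ae_rel_def square_integrable_scale)
  qed
  then show ?thesis
    unfolding L2_def by (simp add: UN_equiv_class[OF equiv_ae_rel _ assms])
qed

lemma L2_inner_class:
  assumes "f \<in> square_integrable M" and "g \<in> square_integrable M"
  shows "L2_inner M (ae_class M f) (ae_class M g) = (\<integral>x. f x * cnj (g x) \<partial>M)"
proof -
  have "congruent2 (ae_rel M) (ae_rel M) (\<lambda>f g. {\<integral>x. f x * cnj (g x) \<partial>M})"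
  proof (rule congruent2I')
    fix f f' g g' assume "(f, f') \<in> ae_rel M" "(g, g') \<in> ae_rel M"
    then have [measurable]: "f \<in> borel_measurable M" "f' \<in> borel_measurable M"
        "g \<in> borel_measurable M" "g' \<in> borel_measurable M"
      and ae: "AE x in M. f x = f' x" "AE x in M. g x = g' x"
      by (auto simp: ae_rel_def square_integrable_def)
    have "AE x in M. f x * cnj (g x) = f' x * cnj (g' x)"
      using ae by eventually_elim simp
    then show "{\<integral>x. f x * cnj (g x) \<partial>M} = {\<integral>x. f' x * cnj (g' x) \<partial>M}"
      by (auto intro!: integral_cong_AE)
  qed
  then show ?thesis
    unfolding L2_inner_def by (simp add: UN_equiv_class2[OF equiv_ae_rel equiv_ae_rel _ assms])
qed

lemma vectorspace_L2: "vectorspace class_ring (L2 M)"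
proof -
  have zero: "(\<lambda>_. 0) \<in> square_integrable M"
    by (simp add: square_integrable_def)
  note ops = L2_carrier L2_zero L2_add L2_smult zero
    square_integrable_add square_integrable_scale
  have "abelian_group (L2 M)"
  proof (rule abelian_groupI)
    fix F assume "F \<in> carrier (L2 M)"
    then obtain f where f: "f \<in> square_integrable M" "F = ae_class M f"
      by (auto simp: L2_carrier)
    then have "ae_class M (\<lambda>x. - 1 * f x) \<oplus>\<^bsub>L2 M\<^esub> F = \<zero>\<^bsub>L2 M\<^esub>"
      using square_integrable_scale[of f M "-1"] by (simp add: L2_add L2_zero)
    then show "\<exists>G\<in>carrier (L2 M). G \<oplus>\<^bsub>L2 M\<^esub> F = \<zero>\<^bsub>L2 M\<^esub>"
      using f square_integrable_scale[of f M "-1"] by (auto simp: L2_carrier)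
  qed (auto simp: ops add_ac)
  then have "Module.module class_ring (L2 M)"
    by (intro module.intro module_axioms.intro class_cring.cring_axioms)
      (auto simp: ops algebra_simps)
  then show ?thesis
    by (intro vectorspace.intro class_field.field_axioms)
qed

section \<open>Linear maps of rank one\<close>

text \<open>
  A nonzero vector \<open>T v\<close> of the range is linearly independent, so in a range of dimension one it is
  already a basis. Thus rank one can be tested on a single known nonzero value of \<open>T\<close>.
\<close>
lemma rank_one_iff:
  assumes lin: "linear_map class_ring V W T"
    and v: "v \<in> carrier V" and nz: "T v \<noteq> \<zero>\<^bsub>W\<^esub>"
  shows "has_rank V W T 1 \<longleftrightarrow> (\<forall>u\<in>carrier V. \<exists>c. T u = c \<odot>\<^bsub>W\<^esub> T v)"
proof -
  interpret T: linear_map class_ring V W T by (rule lin)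
  let ?R = "W\<lparr>carrier := T ` carrier V\<rparr>"
  have sub: "subspace class_ring (T ` carrier V) W"
    using T.imT_is_subspace by (simp add: T.im_def)
  then interpret R: vectorspace class_ring ?R
    by (rule T.W.subspace_is_vs)
  have vR: "T v \<in> carrier ?R" using v by simp
  have span: "R.span {T v} = range (\<lambda>c. c \<odot>\<^bsub>W\<^esub> T v)"
  proof -
    have "R.span {T v} = {R.lincomb a {T v} |a. a \<in> {T v} \<rightarrow> UNIV}"
      using R.finite_span[of "{T v}"] vR by simp
    also have "\<dots> = range (\<lambda>c. c \<odot>\<^bsub>W\<^esub> T v)"
    proof -
      have "R.lincomb a {T v} = a (T v) \<odot>\<^bsub>W\<^esub> T v" for a
        unfolding R.lincomb_def using vR R.smult_closed[OF _ vR, of "a (T v)"]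
          R.r_zero[of "a (T v) \<odot>\<^bsub>W\<^esub> T v"] by simp
      then show ?thesis
        by (auto simp: image_def)
    qed
    finally show ?thesis .
  qed
  have "has_rank V W T 1 \<longleftrightarrow> R.span {T v} = carrier ?R"
  proof
    assume gen: "R.span {T v} = carrier ?R"
    have "R.fin_dim" unfolding R.fin_dim_def using gen vR by (intro exI[of _ "{T v}"]) auto
    moreover have "R.dim = 1" using gen vR nz by (intro R.dim1I[of "T v"]) auto
    ultimately show "has_rank V W T 1" by (simp add: has_rank_def)
  next
    assume "has_rank V W T 1"
    then have fd: "R.fin_dim" and d: "R.dim = 1" by (auto simp: has_rank_def)
    have "R.lin_indpt {T v}"
      using R.lin_dep_iff_in_span[of "{}" "T v"] R.finite_lin_indpt2[of "{}"] vR nz R.span_empty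
      by auto
    then have "R.basis {T v}"
      using fd d vR by (intro R.dim_li_is_basis) auto
    then show "R.span {T v} = carrier ?R"
      by (simp add: R.basis_def)
  qed
  also have "\<dots> \<longleftrightarrow> (\<forall>u\<in>carrier V. \<exists>c. T u = c \<odot>\<^bsub>W\<^esub> T v)"
  proof -
    have "c \<odot>\<^bsub>W\<^esub> T v \<in> T ` carrier V" for c
      using R.smult_closed[OF _ vR, of c] by simp
    then show ?thesis unfolding span by auto
  qed
  finally show ?thesis .
qed

section \<open>Conditional means and the adjoint of composition\<close>

text \<open>
  A version of the conditional expectation of \<open>g\<close> given \<open>A\<close>, as a function of the value of \<open>A\<close>.
  It is characterised by the integrals against square-integrable functions of \<open>A\<close>, which is the form
  of the equation defining the adjoint of \<open>comp_op P A\<close>.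
\<close>
definition is_cond_mean ::
  "'w measure \<Rightarrow> 'x measure \<Rightarrow> ('w \<Rightarrow> 'x) \<Rightarrow> ('w \<Rightarrow> complex) \<Rightarrow> ('x \<Rightarrow> complex) \<Rightarrow> bool" where
  "is_cond_mean P X A g k \<longleftrightarrow> k \<in> square_integrable (distr P X A) \<and>
    (\<forall>h\<in>square_integrable (distr P X A).
      (\<integral>w. h (A w) * cnj (g w) \<partial>P) = (\<integral>x. h x * cnj (k x) \<partial>distr P X A))"

lemma square_integrable_comp:
  assumes A: "A \<in> measurable P X" and f: "f \<in> square_integrable (distr P X A)"
  shows "f \<circ> A \<in> square_integrable P"
proof (rule square_integrableI)
  have [measurable]: "f \<in> borel_measurable X"
    using square_integrableD(1)[OF f] by simp
  note [measurable] = A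
  show "f \<circ> A \<in> borel_measurable P" by (simp add: comp_def)
  show "integrable P (\<lambda>w. (cmod ((f \<circ> A) w))\<^sup>2)"
    using integrable_distr[OF A square_integrableD(2)[OF f]] by simp
qed

lemma comp_op_class:
  assumes A: "A \<in> measurable P X" and f: "f \<in> square_integrable (distr P X A)"
  shows "comp_op P A (ae_class (distr P X A) f) = ae_class P (f \<circ> A)"
proof -
  have "congruent (ae_rel (distr P X A)) (\<lambda>f. ae_class P (f \<circ> A))"
  proof (rule congruentI)
    fix f f' assume rel: "(f, f') \<in> ae_rel (distr P X A)"
    then have "AE x in distr P X A. f x = f' x"
      and si: "f \<in> square_integrable (distr P X A)" "f' \<in> square_integrable (distr P X A)"
      by (auto simp: ae_rel_def)
    then have "AE w in P. (f \<circ> A) w = (f' \<circ> A) w"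
      using AE_distrD[OF A] by fastforce
    then show "ae_class P (f \<circ> A) = ae_class P (f' \<circ> A)"
      using si A by (simp add: ae_class_eq_iff square_integrable_comp)
  qed
  then show ?thesis
    unfolding comp_op_def by (rule UN_equiv_class[OF equiv_ae_rel _ f])
qed

text \<open>
  The inner product separates points: testing the difference \<open>f - g\<close> against itself shows that its
  squared norm is zero. This is why the equation defining the adjoint has at most one solution.
\<close>
lemma AE_eq_if_inner_eq:
  assumes f: "f \<in> square_integrable M" and g: "g \<in> square_integrable M"
    and eq: "\<And>h. h \<in> square_integrable M \<Longrightarrow>
      (\<integral>x. h x * cnj (f x) \<partial>M) = (\<integral>x. h x * cnj (g x) \<partial>M)"
  shows "AE x in M. f x = g x"
proof -
  define d where "d x = f x - g x" for x
  have d: "d \<in> square_integrable M"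
    unfolding d_def by (rule square_integrable_diff[OF f g])
  have "complex_of_real ((cmod (d x))\<^sup>2) = d x * cnj (f x) - d x * cnj (g x)" for x
    unfolding complex_norm_square by (simp add: d_def algebra_simps)
  then have "(\<integral>x. complex_of_real ((cmod (d x))\<^sup>2) \<partial>M)
      = (\<integral>x. d x * cnj (f x) - d x * cnj (g x) \<partial>M)"
    by (simp only:)
  also have "\<dots> = 0"
    using square_integrable_integrable_inner[OF d f] square_integrable_integrable_inner[OF d g]
      eq[OF d] by simp
  finally have "(\<integral>x. (cmod (d x))\<^sup>2 \<partial>M) = 0"
    by (simp only: integral_complex_of_real of_real_eq_0_iff)
  then have "AE x in M. (cmod (d x))\<^sup>2 = 0"
    using integral_nonneg_eq_0_iff_AE[OF square_integrableD(2)[OF d]] by simp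
  then show ?thesis
    by (simp add: d_def)
qed

lemma L2_adjoint_comp_op:
  assumes A: "A \<in> measurable P X" and g: "g \<in> square_integrable P"
    and k: "is_cond_mean P X A g k"
  shows "L2_adjoint (distr P X A) P (comp_op P A) (ae_class P g) = ae_class (distr P X A) k"
proof -
  let ?M = "distr P X A"
  have k_si: "k \<in> square_integrable ?M"
    using k by (simp add: is_cond_mean_def)
  have adj: "(\<forall>H\<in>carrier (L2 ?M). L2_inner P (comp_op P A H) (ae_class P g)
        = L2_inner ?M H (ae_class ?M f))
      \<longleftrightarrow> (\<forall>h\<in>square_integrable ?M. (\<integral>x. h x * cnj (k x) \<partial>?M) = (\<integral>x. h x * cnj (f x) \<partial>?M))"
    if f: "f \<in> square_integrable ?M" for f
    using k g f
    by (simp add: L2_carrier is_cond_mean_def comp_op_class[OF A] L2_inner_class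
        square_integrable_comp[OF A])
  show ?thesis
    unfolding L2_adjoint_def
  proof (rule the_equality)
    show "ae_class ?M k \<in> carrier (L2 ?M) \<and> (\<forall>H\<in>carrier (L2 ?M).
        L2_inner P (comp_op P A H) (ae_class P g) = L2_inner ?M H (ae_class ?M k))"
      using adj[OF k_si] k_si by (simp add: L2_carrier)
  next
    fix F assume F: "F \<in> carrier (L2 ?M) \<and> (\<forall>H\<in>carrier (L2 ?M).
        L2_inner P (comp_op P A H) (ae_class P g) = L2_inner ?M H F)"
    then obtain f where f: "f \<in> square_integrable ?M" "F = ae_class ?M f"
      by (auto simp: L2_carrier)
    then have "AE x in ?M. f x = k x"
      using F adj[OF f(1)] by (intro AE_eq_if_inner_eq[OF f(1) k_si]) auto
    then show "F = ae_class ?M k"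
      using f k_si by (simp add: ae_class_eq_iff)
  qed
qed

section \<open>Existence of conditional means\<close>

lemma is_cond_mean_add:
  assumes A: "A \<in> measurable P X"
    and g: "g \<in> square_integrable P" "g' \<in> square_integrable P"
    and k: "is_cond_mean P X A g k" "is_cond_mean P X A g' k'"
  shows "is_cond_mean P X A (\<lambda>w. g w + g' w) (\<lambda>x. k x + k' x)"
  unfolding is_cond_mean_def
proof (intro conjI ballI)
  have k_si: "k \<in> square_integrable (distr P X A)" "k' \<in> square_integrable (distr P X A)"
    using k by (auto simp: is_cond_mean_def)
  then show "(\<lambda>x. k x + k' x) \<in> square_integrable (distr P X A)"
    by (rule square_integrable_add)
  fix h assume h: "h \<in> square_integrable (distr P X A)"
  have hA: "(\<lambda>w. h (A w)) \<in> square_integrable P"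
    using square_integrable_comp[OF A h] by (simp add: comp_def)
  show "(\<integral>w. h (A w) * cnj (g w + g' w) \<partial>P) = (\<integral>x. h x * cnj (k x + k' x) \<partial>distr P X A)"
    using square_integrable_integrable_inner[OF hA g(1)] square_integrable_integrable_inner[OF hA g(2)]
      square_integrable_integrable_inner[OF h k_si(1)]
      square_integrable_integrable_inner[OF h k_si(2)] k h
    by (simp add: distrib_left is_cond_mean_def)
qed

lemma is_cond_mean_scale:
  assumes "is_cond_mean P X A g k"
  shows "is_cond_mean P X A (\<lambda>w. c * g w) (\<lambda>x. c * k x)"
proof -
  have pull: "a * cnj (c * b) = cnj c * (a * cnj b)" for a b
    by simp
  show ?thesis
    using assms
    by (simp add: is_cond_mean_def square_integrable_scale pull del: complex_cnj_mult)
qed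

text \<open>
  The image \<open>N\<close> under \<open>A\<close> of the measure with density \<open>g\<close> vanishes on the null sets of the
  distribution of \<open>A\<close>. Its Radon-Nikodym density \<open>q\<close> is the conditional mean, as
  \<open>\<integral> h(A) g dP = \<integral> h dN = \<integral> h q d\<mu>\<^sub>A\<close>. What remains is that \<open>q\<close> is square-integrable. For the
  truncation \<open>m = min q n\<close>, which is bounded, the Cauchy-Schwarz inequality gives
  \<open>(\<integral> m\<^sup>2 d\<mu>\<^sub>A)\<^sup>2 \<le> (\<integral> q m d\<mu>\<^sub>A)\<^sup>2 = (\<integral> g m(A) dP)\<^sup>2 \<le> \<integral> g\<^sup>2 dP * \<integral> m\<^sup>2 d\<mu>\<^sub>A\<close>.
  Cancelling the finite factor \<open>\<integral> m\<^sup>2 d\<mu>\<^sub>A\<close> leaves a bound that does not depend on \<open>n\<close>.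
\<close>
lemma cond_mean_nonneg_exists:
  fixes g :: "'w \<Rightarrow> real"
  assumes P: "prob_space P" and A: "A \<in> measurable P X"
    and g [measurable]: "g \<in> borel_measurable P" and nonneg: "\<And>w. 0 \<le> g w"
    and g2: "integrable P (\<lambda>w. (g w)\<^sup>2)"
  shows "\<exists>k. is_cond_mean P X A (\<lambda>w. complex_of_real (g w)) k"
proof -
  interpret prob_space P by (rule P)
  let ?M = "distr P X A"
  interpret M: prob_space ?M by (rule prob_space_distr[OF A])
  note [measurable] = A
  define N where "N = distr (density P (\<lambda>w. ennreal (g w))) X A"
  have A': "A \<in> measurable (density P (\<lambda>w. ennreal (g w))) X" by simp
  have g1: "integrable P g"
    using square_integrable_imp_integrable[OF g g2] .
  have "absolutely_continuous ?M N"
    unfolding absolutely_continuous_def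
  proof
    fix S assume "S \<in> null_sets ?M"
    then have S: "S \<in> sets X" and "emeasure P (A -` S \<inter> space P) = 0"
      by (auto simp: null_sets_distr_iff[OF A])
    then have "A -` S \<inter> space P \<in> null_sets P"
      using measurable_sets[OF A] by auto
    then have "AE w in P. A w \<notin> S"
      by (rule AE_I') (auto)
    then have "AE w in P. w \<in> A -` S \<inter> space P \<longrightarrow> ennreal (g w) = 0"
      by eventually_elim simp
    then have "A -` S \<inter> space P \<in> null_sets (density P (\<lambda>w. ennreal (g w)))"
      using S measurable_sets[OF A S] by (subst null_sets_density_iff) auto
    then show "S \<in> null_sets N"
      using S A' unfolding N_def by (subst null_sets_distr_iff) auto
  qed
  then obtain r where r [measurable]: "r \<in> borel_measurable ?M" and rN: "density ?M r = N"
    using M.Radon_Nikodym[of N] unfolding N_def by auto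
  have nn: "(\<integral>\<^sup>+x. r x * u x \<partial>?M) = (\<integral>\<^sup>+w. ennreal (g w) * u (A w) \<partial>P)"
    if [measurable]: "u \<in> borel_measurable X" for u
  proof -
    have "(\<integral>\<^sup>+x. r x * u x \<partial>?M) = (\<integral>\<^sup>+x. u x \<partial>N)"
      unfolding rN[symmetric] by (subst nn_integral_density) auto
    also have "\<dots> = (\<integral>\<^sup>+w. ennreal (g w) * u (A w) \<partial>P)"
      unfolding N_def by (simp add: nn_integral_distr nn_integral_density)
    finally show ?thesis .
  qed
  have "(\<integral>\<^sup>+x. r x \<partial>?M) = (\<integral>\<^sup>+w. ennreal (g w) \<partial>P)"
    using nn[of "\<lambda>_. 1"] by simp
  also have "\<dots> < \<infinity>"
    using g1 nonneg by (simp add: integrable_iff_bounded)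
  finally have "AE x in ?M. r x \<noteq> \<infinity>"
    by (intro nn_integral_PInf_AE) auto
  \<comment> \<open>The density takes values in the extended reals; as its integral is finite, it can be replaced
    by a real function without changing it almost everywhere.\<close>
  define q where "q x = enn2real (r x)" for x
  have q [measurable]: "q \<in> borel_measurable ?M" unfolding q_def by measurable
  have q': "q \<in> borel_measurable X" using q by simp
  have q0: "0 \<le> q x" for x by (simp add: q_def)
  have rq: "AE x in ?M. r x = ennreal (q x)"
    using \<open>AE x in ?M. r x \<noteq> \<infinity>\<close> by eventually_elim (simp add: q_def less_top)
  then have qN: "density ?M (\<lambda>x. ennreal (q x)) = N"
    unfolding rN[symmetric] by (intro density_cong) auto
  define K where "K = (\<integral>\<^sup>+w. (ennreal (g w))\<^sup>2 \<partial>P)"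
  have K: "K < \<infinity>"
    using g2 nonneg by (simp add: K_def integrable_iff_bounded ennreal_power)
  have trunc: "(\<integral>\<^sup>+x. (ennreal (min (q x) n))\<^sup>2 \<partial>?M) \<le> K" (is "?I \<le> K") for n :: nat
  proof -
    define m where "m x = ennreal (min (q x) n)" for x
    have [measurable]: "m \<in> borel_measurable X"
      unfolding m_def using q' by measurable
    have I: "?I = (\<integral>\<^sup>+w. (m (A w))\<^sup>2 \<partial>P)"
      by (subst nn_integral_distr) (auto simp: m_def[symmetric])
    have "?I \<le> (\<integral>\<^sup>+x. ennreal (real n ^ 2) \<partial>?M)"
      by (intro nn_integral_mono)
        (auto simp: ennreal_power q0 intro!: power_mono ennreal_leI)
    also have "\<dots> < \<infinity>"
      using M.emeasure_space_1 by simp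
    finally have fin: "?I < \<infinity>" .
    have "?I \<le> (\<integral>\<^sup>+x. r x * m x \<partial>?M)"
      using rq by (intro nn_integral_mono_AE, eventually_elim)
        (auto simp: m_def power2_eq_square intro!: mult_right_mono ennreal_leI)
    also have "\<dots> = (\<integral>\<^sup>+w. ennreal (g w) * m (A w) \<partial>P)"
      by (rule nn) simp
    finally have "?I\<^sup>2 \<le> (\<integral>\<^sup>+w. ennreal (g w) * m (A w) \<partial>P)\<^sup>2"
      by (intro power_mono) auto
    also have "\<dots> \<le> K * ?I"
      unfolding I K_def by (rule Cauchy_Schwarz_nn_integral) auto
    finally have "?I * ?I \<le> K * ?I"
      by (simp add: power2_eq_square)
    moreover have "K * ?I < ?I * ?I" if "K < ?I"
      using that fin by (intro ennreal_mult_strict_right_mono) (auto intro: le_less_trans)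
    ultimately show ?thesis
      by (meson leD leI)
  qed
  \<comment> \<open>At each point the truncations are eventually equal to \<open>q\<close>, so Fatou's lemma carries the
    uniform bound over to \<open>q\<close>.\<close>
  have "(\<integral>\<^sup>+x. (ennreal (q x))\<^sup>2 \<partial>?M)
      = (\<integral>\<^sup>+x. liminf (\<lambda>n. (ennreal (min (q x) (real n)))\<^sup>2) \<partial>?M)"
  proof (rule nn_integral_cong)
    fix x
    have "eventually (\<lambda>n. (ennreal (min (q x) (real n)))\<^sup>2 = (ennreal (q x))\<^sup>2) sequentially"
      using eventually_ge_at_top[of "nat \<lceil>q x\<rceil>"] by eventually_elim (simp add: min_absorb1 nat_le_iff ceiling_le_iff)
    then have "(\<lambda>n. (ennreal (min (q x) (real n)))\<^sup>2) \<longlonglongrightarrow> (ennreal (q x))\<^sup>2"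
      by (rule tendsto_eventually)
    then show "(ennreal (q x))\<^sup>2 = liminf (\<lambda>n. (ennreal (min (q x) (real n)))\<^sup>2)"
      by (simp add: lim_imp_Liminf)
  qed
  also have "\<dots> \<le> liminf (\<lambda>n. \<integral>\<^sup>+x. (ennreal (min (q x) (real n)))\<^sup>2 \<partial>?M)"
    by (rule nn_integral_liminf) measurable
  also have "\<dots> \<le> K"
    using trunc by (intro Liminf_le) auto
  finally have "(\<integral>\<^sup>+x. (ennreal (q x))\<^sup>2 \<partial>?M) < \<infinity>"
    using K by simp
  then have q2: "integrable ?M (\<lambda>x. (q x)\<^sup>2)"
    using q0 by (simp add: integrable_iff_bounded ennreal_power)
  have "is_cond_mean P X A (\<lambda>w. complex_of_real (g w)) (\<lambda>x. complex_of_real (q x))"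
    unfolding is_cond_mean_def
  proof (intro conjI ballI)
    show "(\<lambda>x. complex_of_real (q x)) \<in> square_integrable ?M"
      using q2 q by (intro square_integrableI) auto
    fix h assume "h \<in> square_integrable ?M"
    then have h [measurable]: "h \<in> borel_measurable X"
      using square_integrableD(1) by fastforce
    have "(\<integral>w. h (A w) * cnj (complex_of_real (g w)) \<partial>P) = (\<integral>w. g w *\<^sub>R h (A w) \<partial>P)"
      by (simp add: scaleR_conv_of_real mult.commute)
    also have "\<dots> = (\<integral>w. h (A w) \<partial>density P (\<lambda>w. ennreal (g w)))"
      using nonneg by (subst integral_density) auto
    also have "\<dots> = (\<integral>x. h x \<partial>N)"
      unfolding N_def by (subst integral_distr) auto
    also have "\<dots> = (\<integral>x. q x *\<^sub>R h x \<partial>?M)"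
      unfolding qN[symmetric] using q0 by (subst integral_density) auto
    also have "\<dots> = (\<integral>x. h x * cnj (complex_of_real (q x)) \<partial>?M)"
      by (simp add: scaleR_conv_of_real mult.commute)
    finally show "(\<integral>w. h (A w) * cnj (complex_of_real (g w)) \<partial>P)
        = (\<integral>x. h x * cnj (complex_of_real (q x)) \<partial>?M)" .
  qed
  then show ?thesis by blast
qed

text \<open>
  A complex function is a linear combination of the positive and negative parts of its real and
  imaginary parts, and each of these is dominated by its modulus.
\<close>
lemma cond_mean_exists:
  assumes P: "prob_space P" and A: "A \<in> measurable P X" and g: "g \<in> square_integrable P"
  shows "\<exists>k. is_cond_mean P X A g k"
proof -
  note [measurable] = square_integrableD(1)[OF g]
  define pos where "pos u = (\<lambda>w. complex_of_real (max 0 (u w)))" for u :: "'a \<Rightarrow> real"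
  have part: "pos u \<in> square_integrable P \<and> (\<exists>k. is_cond_mean P X A (pos u) k)"
    if [measurable]: "u \<in> borel_measurable P" and le: "\<And>w. \<bar>u w\<bar> \<le> cmod (g w)"
    for u :: "'a \<Rightarrow> real"
  proof -
    have "AE w in P. norm ((max 0 (u w))\<^sup>2) \<le> norm ((cmod (g w))\<^sup>2)"
      using le by (intro AE_I2) (auto simp: max_def intro!: power_mono intro: order_trans[OF abs_ge_self])
    then have "integrable P (\<lambda>w. (max 0 (u w))\<^sup>2)"
      by (intro Bochner_Integration.integrable_bound[OF square_integrableD(2)[OF g],
            where g = "\<lambda>w. (max 0 (u w))\<^sup>2"]) measurable
    then show ?thesis
      unfolding pos_def
      by (intro conjI cond_mean_nonneg_exists[OF P A] square_integrableI) auto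
  qed
  note parts = part[of "\<lambda>w. Re (g w)"] part[of "\<lambda>w. - Re (g w)"]
    part[of "\<lambda>w. Im (g w)"] part[of "\<lambda>w. - Im (g w)"]
  have "g = (\<lambda>w. ((1 * pos (\<lambda>w. Re (g w)) w + (- 1) * pos (\<lambda>w. - Re (g w)) w)
      + \<i> * pos (\<lambda>w. Im (g w)) w) + (- \<i>) * pos (\<lambda>w. - Im (g w)) w)"
    by (auto simp: pos_def complex_eq_iff max_def fun_eq_iff)
  moreover
  have add: "f \<in> square_integrable P \<and> (\<exists>k. is_cond_mean P X A f k) \<Longrightarrow>
      f' \<in> square_integrable P \<and> (\<exists>k. is_cond_mean P X A f' k) \<Longrightarrow>
      (\<lambda>w. f w + f' w) \<in> square_integrable P \<and> (\<exists>k. is_cond_mean P X A (\<lambda>w. f w + f' w) k)" for f f'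
    using is_cond_mean_add[OF A] square_integrable_add by blast
  have scale: "f \<in> square_integrable P \<and> (\<exists>k. is_cond_mean P X A f k) \<Longrightarrow>
      (\<lambda>w. c * f w) \<in> square_integrable P \<and> (\<exists>k. is_cond_mean P X A (\<lambda>w. c * f w) k)" for f c
    using is_cond_mean_scale square_integrable_scale by blast
  have "(\<lambda>w. ((1 * pos (\<lambda>w. Re (g w)) w + (- 1) * pos (\<lambda>w. - Re (g w)) w)
      + \<i> * pos (\<lambda>w. Im (g w)) w) + (- \<i>) * pos (\<lambda>w. - Im (g w)) w) \<in> square_integrable P \<and>
     (\<exists>k. is_cond_mean P X A (\<lambda>w. ((1 * pos (\<lambda>w. Re (g w)) w + (- 1) * pos (\<lambda>w. - Re (g w)) w)
      + \<i> * pos (\<lambda>w. Im (g w)) w) + (- \<i>) * pos (\<lambda>w. - Im (g w)) w) k)"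
    by (intro add scale parts) (auto simp: abs_Re_le_cmod abs_Im_le_cmod)
  ultimately show ?thesis by simp
qed

section \<open>The transfer operator\<close>

lemma transfer_op_class:
  assumes A: "A \<in> measurable P X" and B: "B \<in> measurable P X"
    and f: "f \<in> square_integrable (distr P X B)" and k: "is_cond_mean P X A (f \<circ> B) k"
  shows "transfer_op P X A B (ae_class (distr P X B) f) = ae_class (distr P X A) k"
  unfolding transfer_op_def o_apply[of "L2_adjoint _ _ _" "comp_op P B"] comp_op_class[OF B f]
  by (rule L2_adjoint_comp_op[OF A square_integrable_comp[OF B f] k])

lemma linear_map_transfer_op:
  assumes P: "prob_space P" and A: "A \<in> measurable P X" and B: "B \<in> measurable P X"
  shows "linear_map class_ring (L2 (distr P X B)) (L2 (distr P X A)) (transfer_op P X A B)"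
proof -
  let ?V = "L2 (distr P X B)" and ?W = "L2 (distr P X A)" and ?T = "transfer_op P X A B"
  interpret V: vectorspace class_ring ?V by (rule vectorspace_L2)
  interpret W: vectorspace class_ring ?W by (rule vectorspace_L2)
  have rep: "\<exists>f k. F = ae_class (distr P X B) f \<and> f \<in> square_integrable (distr P X B)
      \<and> is_cond_mean P X A (f \<circ> B) k" if "F \<in> carrier ?V" for F
    using that cond_mean_exists[OF P A square_integrable_comp[OF B]] by (auto simp: L2_carrier)
  have "?T \<in> module_hom class_ring ?V ?W"
    unfolding module_hom_def
  proof (intro CollectI conjI allI impI funcsetI)
    fix F assume "F \<in> carrier ?V"
    then obtain f k where F: "F = ae_class (distr P X B) f" "f \<in> square_integrable (distr P X B)"
        "is_cond_mean P X A (f \<circ> B) k"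
      using rep[of F] by blast
    then show "?T F \<in> carrier ?W"
      using transfer_op_class[OF A B F(2,3)] by (auto simp: L2_carrier is_cond_mean_def)
  next
    fix F G assume FG: "F \<in> carrier ?V \<and> G \<in> carrier ?V"
    then obtain f k where F: "F = ae_class (distr P X B) f" "f \<in> square_integrable (distr P X B)"
        "is_cond_mean P X A (f \<circ> B) k"
      using rep[of F] by blast
    from FG obtain g l where G: "G = ae_class (distr P X B) g" "g \<in> square_integrable (distr P X B)"
        "is_cond_mean P X A (g \<circ> B) l"
      using rep[of G] by blast
    have "is_cond_mean P X A ((\<lambda>x. f x + g x) \<circ> B) (\<lambda>x. k x + l x)"
      using is_cond_mean_add[OF A square_integrable_comp[OF B F(2)] square_integrable_comp[OF B G(2)]
          F(3) G(3)] by (simp add: comp_def)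
    from transfer_op_class[OF A B square_integrable_add[OF F(2) G(2)] this]
      transfer_op_class[OF A B F(2,3)] transfer_op_class[OF A B G(2,3)]
    show "?T (F \<oplus>\<^bsub>?V\<^esub> G) = ?T F \<oplus>\<^bsub>?W\<^esub> ?T G"
      using F G by (simp add: L2_add is_cond_mean_def)
  next
    fix c F assume "c \<in> carrier (class_ring :: complex ring) \<and> F \<in> carrier ?V"
    then obtain f k where F: "F = ae_class (distr P X B) f" "f \<in> square_integrable (distr P X B)"
        "is_cond_mean P X A (f \<circ> B) k"
      using rep[of F] by blast
    have "is_cond_mean P X A ((\<lambda>x. c * f x) \<circ> B) (\<lambda>x. c * k x)"
      using is_cond_mean_scale[OF F(3)] by (simp add: comp_def)
    from transfer_op_class[OF A B square_integrable_scale[OF F(2)] this]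
      transfer_op_class[OF A B F(2,3)]
    show "?T (c \<odot>\<^bsub>?V\<^esub> F) = c \<odot>\<^bsub>?W\<^esub> ?T F"
      using F by (simp add: L2_smult is_cond_mean_def)
  qed
  then show ?thesis
    by (intro linear_map.intro mod_hom.intro mod_hom_axioms.intro
        V.vectorspace_axioms W.vectorspace_axioms V.module_axioms W.module_axioms)
qed

lemma (in prob_space) const_square_integrable: "(\<lambda>_. c) \<in> square_integrable M"
  by (rule square_integrable_bounded[of _ "cmod c"]) auto

text \<open>
  The class of \<open>1\<close> is a nonzero vector fixed by the transfer operator, so by \<open>rank_one_iff\<close> the rank is
  one if and only if all values are multiples of it, that is, classes of constants. That a value is
  the class of a constant means that this constant is itself a conditional mean, because conditional
  means are closed under changes on null sets.
\<close>
lemma transfer_op_rank_one_iff: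
  assumes P: "prob_space P" and A: "A \<in> measurable P X" and B: "B \<in> measurable P X"
  shows "has_rank (L2 (distr P X B)) (L2 (distr P X A)) (transfer_op P X A B) 1 \<longleftrightarrow>
    (\<forall>f\<in>square_integrable (distr P X B). \<exists>c. is_cond_mean P X A (f \<circ> B) (\<lambda>_. c))"
proof -
  let ?T = "transfer_op P X A B"
  interpret MA: prob_space "distr P X A" by (rule prob_space.prob_space_distr[OF P A])
  interpret MB: prob_space "distr P X B" by (rule prob_space.prob_space_distr[OF P B])
  have "is_cond_mean P X A ((\<lambda>_. 1) \<circ> B) (\<lambda>_. 1)"
    unfolding is_cond_mean_def
  proof (intro conjI ballI MA.const_square_integrable)
    fix h assume "h \<in> square_integrable (distr P X A)"
    then have "h \<in> borel_measurable X" using square_integrableD(1) by fastforce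
    then show "(\<integral>w. h (A w) * cnj (((\<lambda>_. 1) \<circ> B) w) \<partial>P) = (\<integral>x. h x * cnj 1 \<partial>distr P X A)"
      using A by (simp add: integral_distr)
  qed
  then have one: "?T (ae_class (distr P X B) (\<lambda>_. 1)) = ae_class (distr P X A) (\<lambda>_. 1)"
    by (rule transfer_op_class[OF A B MB.const_square_integrable])
  have nz: "ae_class (distr P X A) (\<lambda>_. 1) \<noteq> \<zero>\<^bsub>L2 (distr P X A)\<^esub>"
    by (simp add: L2_zero ae_class_eq_iff MA.const_square_integrable)
  have "has_rank (L2 (distr P X B)) (L2 (distr P X A)) ?T 1 \<longleftrightarrow>
      (\<forall>f\<in>square_integrable (distr P X B). \<exists>c.
        ?T (ae_class (distr P X B) f) = ae_class (distr P X A) (\<lambda>_. c))"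
    using rank_one_iff[OF linear_map_transfer_op[OF P A B],
        of "ae_class (distr P X B) (\<lambda>_. 1)"] nz
    by (simp add: one L2_carrier L2_smult MA.const_square_integrable MB.const_square_integrable)
  also have "\<dots> \<longleftrightarrow>
      (\<forall>f\<in>square_integrable (distr P X B). \<exists>c. is_cond_mean P X A (f \<circ> B) (\<lambda>_. c))"
  proof (intro ball_cong ex_cong1 refl)
    fix f c assume f: "f \<in> square_integrable (distr P X B)"
    obtain k where k: "is_cond_mean P X A (f \<circ> B) k"
      using cond_mean_exists[OF P A square_integrable_comp[OF B f]] by blast
    show "?T (ae_class (distr P X B) f) = ae_class (distr P X A) (\<lambda>_. c)
      \<longleftrightarrow> is_cond_mean P X A (f \<circ> B) (\<lambda>_. c)"
    proof
      assume "is_cond_mean P X A (f \<circ> B) (\<lambda>_. c)"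
      then show "?T (ae_class (distr P X B) f) = ae_class (distr P X A) (\<lambda>_. c)"
        by (rule transfer_op_class[OF A B f])
    next
      assume "?T (ae_class (distr P X B) f) = ae_class (distr P X A) (\<lambda>_. c)"
      then have ae: "AE x in distr P X A. k x = c"
        using k by (simp add: transfer_op_class[OF A B f k] ae_class_eq_iff is_cond_mean_def
            MA.const_square_integrable)
      have "(\<integral>x. h x * cnj (k x) \<partial>distr P X A) = (\<integral>x. h x * cnj c \<partial>distr P X A)"
        if "h \<in> square_integrable (distr P X A)" for h
      proof (rule integral_cong_AE)
        show "AE x in distr P X A. h x * cnj (k x) = h x * cnj c"
          using ae by eventually_elim simp
        have [measurable]: "h \<in> borel_measurable (distr P X A)" "k \<in> borel_measurable (distr P X A)"
          using that k square_integrableD(1) by (auto simp: is_cond_mean_def simp del: measurable_distr_eq1)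
        show "(\<lambda>x. h x * cnj (k x)) \<in> borel_measurable (distr P X A)"
          and "(\<lambda>x. h x * cnj c) \<in> borel_measurable (distr P X A)"
          by measurable
      qed
      then show "is_cond_mean P X A (f \<circ> B) (\<lambda>_. c)"
        using k by (simp add: is_cond_mean_def MA.const_square_integrable)
    qed
  qed
  finally show ?thesis .
qed

section \<open>Independence and constant conditional means\<close>

lemma indep_var_imp_is_cond_mean_const:
  assumes P: "prob_space P" and indep: "prob_space.indep_var P X A X B"
    and f: "f \<in> square_integrable (distr P X B)"
  shows "is_cond_mean P X A (f \<circ> B) (\<lambda>_. \<integral>w. f (B w) \<partial>P)"
proof -
  interpret prob_space P by (rule P)
  have A [measurable]: "A \<in> measurable P X" and B [measurable]: "B \<in> measurable P X"
    using indep indep_var_rv1 indep_var_rv2 by blast+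
  interpret MA: prob_space "distr P X A" by (rule prob_space_distr[OF A])
  have f' [measurable]: "f \<in> borel_measurable X"
    using square_integrableD(1)[OF f] by simp
  have intf: "integrable P (\<lambda>w. cnj (f (B w)))"
    using square_integrable_integrable_inner[OF const_square_integrable[of 1]
        square_integrable_comp[OF B f]] by simp
  show ?thesis
    unfolding is_cond_mean_def
  proof (intro conjI ballI MA.const_square_integrable)
    fix h assume h: "h \<in> square_integrable (distr P X A)"
    then have h' [measurable]: "h \<in> borel_measurable X"
      using square_integrableD(1) by fastforce
    have inth: "integrable P (\<lambda>w. h (A w))"
      using square_integrable_integrable_inner[OF square_integrable_comp[OF A h]
          const_square_integrable[of 1]] by simp
    have "indep_var borel (h \<circ> A) borel ((\<lambda>x. cnj (f x)) \<circ> B)"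
      by (rule indep_var_compose[OF indep]) measurable
    then have "(\<integral>w. h (A w) * cnj (f (B w)) \<partial>P) = (\<integral>w. h (A w) \<partial>P) * (\<integral>w. cnj (f (B w)) \<partial>P)"
      using indep_var_lebesgue_integral(1)[of "h \<circ> A" "(\<lambda>x. cnj (f x)) \<circ> B"] inth intf
      by (simp add: comp_def)
    also have "\<dots> = (\<integral>x. h x * cnj (\<integral>w. f (B w) \<partial>P) \<partial>distr P X A)"
      by (simp add: integral_distr)
    finally show "(\<integral>w. h (A w) * cnj ((f \<circ> B) w) \<partial>P)
        = (\<integral>x. h x * cnj (\<integral>w. f (B w) \<partial>P) \<partial>distr P X A)"
      by simp
  qed
qed

text \<open>
  Independence of \<open>A\<close> and \<open>B\<close> is defined through the generated \<open>\<sigma>\<close>-algebras. The preimages of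
  measurable sets generate them and are stable under intersection, so it suffices to check the product
  rule on preimages.
\<close>
lemma (in prob_space) indep_varI:
  assumes A: "A \<in> measurable M S" and B: "B \<in> measurable M T"
    and prod: "\<And>K L. K \<in> sets S \<Longrightarrow> L \<in> sets T \<Longrightarrow>
      prob ((A -` K \<inter> space M) \<inter> (B -` L \<inter> space M))
        = prob (A -` K \<inter> space M) * prob (B -` L \<inter> space M)"
  shows "indep_var S A T B"
proof -
  let ?\<A> = "{A -` K \<inter> space M |K. K \<in> sets S}" and ?\<B> = "{B -` L \<inter> space M |L. L \<in> sets T}"
  have "indep_set ?\<A> ?\<B>"
    unfolding indep_sets2_eq using measurable_sets[OF A] measurable_sets[OF B] prod by auto
  moreover have stable: "Int_stable {C -` K \<inter> space M |K. K \<in> sets N}"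
    for C and N :: "'z measure"
  proof (rule Int_stableI)
    fix a b
    assume "a \<in> {C -` K \<inter> space M |K. K \<in> sets N}" "b \<in> {C -` K \<inter> space M |K. K \<in> sets N}"
    then obtain K K' where K: "a = C -` K \<inter> space M" "b = C -` K' \<inter> space M"
        "K \<in> sets N" "K' \<in> sets N"
      by blast
    then have "a \<inter> b = C -` (K \<inter> K') \<inter> space M"
      by auto
    with K(3,4) show "a \<inter> b \<in> {C -` K \<inter> space M |K. K \<in> sets N}"
      by blast
  qed
  ultimately have "indep_set (sigma_sets (space M) ?\<A>) (sigma_sets (space M) ?\<B>)"
    using indep_set_sigma_sets stable by blast
  then show ?thesis
    using A B by (simp add: indep_var_eq)
qed

lemma integral_indicator_complex:
  assumes "S \<in> sets M"
  shows "(\<integral>x. indicator S x \<partial>M) = complex_of_real (measure M S)"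
proof -
  have "(\<integral>x. indicator S x \<partial>M) = (\<integral>x. complex_of_real (indicator S x) \<partial>M)"
    by (intro Bochner_Integration.integral_cong) (auto simp: indicator_def)
  also have "\<dots> = complex_of_real (measure M S)"
    using sets.sets_into_space[OF assms] by (simp add: Int_absorb2)
  finally show ?thesis .
qed

lemma indep_var_if_cond_mean_const:
  assumes P: "prob_space P" and A: "A \<in> measurable P X" and B: "B \<in> measurable P X"
    and const: "\<And>f. f \<in> square_integrable (distr P X B) \<Longrightarrow> \<exists>c. is_cond_mean P X A (f \<circ> B) (\<lambda>_. c)"
  shows "prob_space.indep_var P X A X B"
proof -
  interpret prob_space P by (rule P)
  note [measurable] = A B
  interpret MA: prob_space "distr P X A" by (rule prob_space_distr[OF A])
  interpret MB: prob_space "distr P X B" by (rule prob_space_distr[OF B])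
  show ?thesis
  proof (rule indep_varI[OF A B])
    fix K L assume K [measurable]: "K \<in> sets X" and L [measurable]: "L \<in> sets X"
    let ?K = "A -` K \<inter> space P" and ?L = "B -` L \<inter> space P"
    have [measurable]: "?K \<in> sets P" "?L \<in> sets P"
      using measurable_sets A B K L by blast+
    have "indicator L \<in> square_integrable (distr P X B)"
      by (rule MB.square_integrable_bounded[of _ 1]) (auto simp: indicator_def)
    then obtain c where c: "is_cond_mean P X A (indicator L \<circ> B) (\<lambda>_. c)"
      using const by blast
    \<comment> \<open>\<open>J\<close> is kept general, because this is used for \<open>K\<close> and for the whole space.\<close>
    have ind: "prob (S \<inter> ?L) = measure (distr P X A) J * cnj c"
      if [measurable]: "J \<in> sets X" and S: "S = A -` J \<inter> space P" for J S
    proof -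
      have "indicator J \<in> square_integrable (distr P X A)"
        by (rule MA.square_integrable_bounded[of _ 1]) (auto simp: indicator_def)
      then have "(\<integral>w. indicator J (A w) * cnj (indicator L (B w)) \<partial>P)
          = (\<integral>x. indicator J x * cnj c \<partial>distr P X A)"
        using c by (simp add: is_cond_mean_def)
      moreover have "(\<integral>w. indicator J (A w) * cnj (indicator L (B w)) \<partial>P)
          = (\<integral>w. indicator (S \<inter> ?L) w \<partial>P)"
        by (intro Bochner_Integration.integral_cong) (auto simp: indicator_def S)
      ultimately have "(\<integral>w. indicator (S \<inter> ?L) w \<partial>P) = (\<integral>x. indicator J x \<partial>distr P X A) * cnj c"
        by simp
      then show ?thesis
        using that by (simp add: integral_indicator_complex measurable_sets[OF A])
    qed
    have "complex_of_real (prob ?L) = cnj c"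
      using ind[of "space X" "space P"] measurable_space[OF A] MA.prob_space
      by (auto simp: Int_absorb1)
    then have "complex_of_real (prob (?K \<inter> ?L)) = complex_of_real (prob ?K * prob ?L)"
      using ind[of K ?K] by (simp add: measure_distr)
    then show "prob (?K \<inter> ?L) = prob ?K * prob ?L"
      by (simp only: of_real_eq_iff)
  qed
qed

theorem proposition2p8:
  fixes P :: "'w measure" and X :: "'x measure" and A B :: "'w \<Rightarrow> 'x"
  assumes "prob_space P"
    and "A \<in> measurable P X"
    and "B \<in> measurable P X"
  shows "prob_space.indep_var P X A X B \<longleftrightarrow>
    has_rank (L2 (distr P X B)) (L2 (distr P X A)) (transfer_op P X A B) 1"
  unfolding transfer_op_rank_one_iff[OF assms]
  using indep_var_imp_is_cond_mean_const[OF assms(1)] indep_var_if_cond_mean_const[OF assms]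
  by blast

end
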